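(* Let $z$ be a parameter. For integers $w\geq r\geq 2$ with $r$ even, we have $$\sum_{|\boldsymbol{k}|_r=w}\ \sum_{d=1}^{r-1}\left[(1+z)^{\mathcal{W}_d(\boldsymbol{k})-1}\bigl(1+z^{\,w-\mathcal{W}_d(\boldsymbol{k})-1}\bigr)+(-z)^{\mathcal{W}_d(\boldsymbol{k})-1}\right]T_{\mathcal{A}}(\boldsymbol{k})=0.$$
   Context: Let $\mathcal{P}$ be the set of primes and $\mathcal{A}:=\prod_{p\in\mathcal{P}}(\mathbb{Z}/p\mathbb{Z})\big/\bigoplus_{p\in\mathcal{P}}(\mathbb{Z}/p\mathbb{Z})$, a $\mathbb{Q}$-algebra in which an element is determined by its components at all but finitely many primes. "Parameter" means an indeterminate: the identity is one of polynomials in $z$ with coefficients in $\mathcal{A}$ (all exponents occurring are non-negative). An index is a finite sequence $\boldsymbol{k}=(k_1,\ldots,k_r)$ of positive integers. The finite multiple $T$-value is $$T_{\mathcal{A}}(k_1,\ldots,k_r):=\Bigl(2^r\sum_{\substack{0<m_1<\cdots<m_r<p\\ m_i\equiv i\ (\mathrm{mod}\ 2)}}\frac{1}{m_1^{k_1}\cdots m_r^{k_r}}\bmod p\Bigr)_{p\in\mathcal{P}}\in\mathcal{A}.$$ The notation $\sum_{|\boldsymbol{k}|_{r}=w}$ means the sum over all indices $\boldsymbol{k}=(k_1,\ldots,k_r)$ of positive integers with $k_1+\cdots+k_r=w$. For $1\leq d\leq r$, $\mathcal{W}_d(\boldsymbol{k}):=k_{r-d+1}+\cdots+k_r$ is the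 sum of the last $d$ components of $\boldsymbol{k}$. *)

theory Defs
  imports
    "HOL-Number_Theory.Number_Theory"
    "HOL-Computational_Algebra.Polynomial"
begin

text \<open>
  The ring \<open>\<A> = (\<Prod>\<^sub>p \<int>/p\<int>) / (\<Oplus>\<^sub>p \<int>/p\<int>)\<close>. A function \<open>f :: nat \<Rightarrow> int\<close> represents the
  family of residue classes \<open>(f p mod p)\<close>, \<open>p\<close> prime; its values at non-primes are irrelevant.
  Two families are identified iff their difference lies in the direct sum, i.e. iff
  their components differ at only finitely many primes.
\<close>

definition fin_diff :: "(nat \<Rightarrow> int) \<Rightarrow> (nat \<Rightarrow> int) \<Rightarrow> bool" where
  "fin_diff f g \<longleftrightarrow> finite {p. prime p \<and> \<not> [f p = g p] (mod int p)}"

lemma fin_diff_combine: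
  assumes "fin_diff f g" "fin_diff f' g'"
    and "\<And>p. [f p = g p] (mod int p) \<Longrightarrow> [f' p = g' p] (mod int p) \<Longrightarrow> [h p = h' p] (mod int p)"
  shows "fin_diff h h'"
  unfolding fin_diff_def
  by (rule finite_subset[OF _ finite_UnI[OF assms(1,2)[unfolded fin_diff_def]]])
     (use assms(3) in auto)

lemma fin_diff_refl: "fin_diff f f"
  by (simp add: fin_diff_def)

lemma equivp_fin_diff: "equivp fin_diff"
proof (rule equivpI)
  show "reflp fin_diff"
    by (simp add: reflpI fin_diff_refl)
  show "symp fin_diff"
    by (rule sympI) (simp add: fin_diff_def cong_sym_eq)
  show "transp fin_diff"
    by (rule transpI, erule (1) fin_diff_combine) (blast intro: cong_trans)
qed

quotient_type ring_A = "nat \<Rightarrow> int" / fin_diff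
  by (rule equivp_fin_diff)

instantiation ring_A :: comm_ring_1
begin

lift_definition zero_ring_A :: ring_A is "\<lambda>_. 0" .

lift_definition one_ring_A :: ring_A is "\<lambda>_. 1" .

lift_definition plus_ring_A :: "ring_A \<Rightarrow> ring_A \<Rightarrow> ring_A" is "\<lambda>f g p. f p + g p"
  by (erule (1) fin_diff_combine) (rule cong_add)

lift_definition minus_ring_A :: "ring_A \<Rightarrow> ring_A \<Rightarrow> ring_A" is "\<lambda>f g p. f p - g p"
  by (erule (1) fin_diff_combine) (rule cong_diff)

lift_definition uminus_ring_A :: "ring_A \<Rightarrow> ring_A" is "\<lambda>f p. - f p"
  by (erule fin_diff_combine[OF _ fin_diff_refl]) (simp add: cong_minus_minus_iff)

lift_definition times_ring_A :: "ring_A \<Rightarrow> ring_A \<Rightarrow> ring_A" is "\<lambda>f g p. f p * g p"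
  by (erule (1) fin_diff_combine) (rule cong_mult)

instance
proof
  show "(0 :: ring_A) \<noteq> 1"
  proof (transfer, rule notI)
    assume "fin_diff (\<lambda>_. 0) (\<lambda>_. 1)"
    moreover have "{p :: nat. prime p \<and> \<not> [0 = 1] (mod int p)} = {p. prime p}"
      by (auto simp: cong_def zmod_int[symmetric] dest: prime_gt_1_nat)
    ultimately show False
      using primes_infinite by (simp add: fin_diff_def)
  qed
qed (transfer; simp add: fin_diff_refl algebra_simps)+

end

definition indices :: "nat \<Rightarrow> nat \<Rightarrow> nat list set" where
  "indices r w = {k. length k = r \<and> (\<forall>i\<in>set k. 0 < i) \<and> sum_list k = w}"

lemma finite_indices: "finite (indices r w)"
proof (rule finite_subset)
  show "indices r w \<subseteq> {k. set k \<subseteq> {..w} \<and> length k = r}"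
    by (auto simp: indices_def intro: member_le_sum_list)
  show "finite {k. set k \<subseteq> {..w} \<and> length k = r}"
    by (rule finite_lists_length_eq) simp
qed

definition last_weight :: "nat \<Rightarrow> nat list \<Rightarrow> nat" where
  "last_weight d k = sum_list (drop (length k - d) k)"

text \<open>
  In the range \<open>1 \<le> d < r\<close> the natural-number subtractions \<open>last_weight d k - 1\<close> and
  \<open>w - last_weight d k - 1\<close> are never truncated:
\<close>

lemma last_weight_bounds:
  assumes k: "k \<in> indices r w" and d: "1 \<le> d" "d < r"
  shows "1 \<le> last_weight d k" and "1 + last_weight d k \<le> w"
proof -
  have pos: "1 \<le> sum_list xs" if "xs \<noteq> []" "set xs \<subseteq> set k" for xs
    using that k by (cases xs) (auto simp: indices_def)
  have w: "w = sum_list (take (r - d) k) + last_weight d k"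
    using k by (auto simp: indices_def last_weight_def simp flip: sum_list_append)
  show "1 \<le> last_weight d k"
    unfolding last_weight_def using k d
    by (intro pos set_drop_subset) (auto simp: indices_def)
  have "1 \<le> sum_list (take (r - d) k)"
    using k d by (intro pos set_take_subset) (auto simp: indices_def)
  with w show "1 + last_weight d k \<le> w"
    by simp
qed

text \<open>
  Tuples \<open>0 < m\<^sub>1 < \<dots> < m\<^sub>r < p\<close> with \<open>m\<^sub>i \<equiv> i (mod 2)\<close>. List positions start at \<open>0\<close>, so \<open>m\<^sub>i\<close> is
  \<open>m ! (i - 1)\<close>.
\<close>

definition T_range :: "nat \<Rightarrow> nat \<Rightarrow> nat list set" where
  "T_range r p = {m. length m = r \<and> set m \<subseteq> {0<..<p} \<and> sorted_wrt (<) m \<and>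
                     (\<forall>i\<in>{1..r}. [m ! (i - 1) = i] (mod 2))}"

lemma finite_T_range: "finite (T_range r p)"
  by (rule finite_subset[OF _ finite_lists_length_eq[of "{0<..<p}" r]]) (auto simp: T_range_def)

text \<open>
  For prime \<open>p\<close> all entries of \<open>m \<in> T_range r p\<close> are units mod \<open>p\<close>, so \<open>modular_inverse\<close> is the
  inverse of the product in \<open>\<int>/p\<int>\<close>.
\<close>

definition T_mod :: "nat list \<Rightarrow> nat \<Rightarrow> int" where
  "T_mod k p = 2 ^ length k *
     (\<Sum>m\<in>T_range (length k) p.
        modular_inverse (int p) (\<Prod>i<length k. int (m ! i) ^ (k ! i)))"

lift_definition T_A :: "nat list \<Rightarrow> ring_A" is T_mod .

end

theory Submission
  imports Defs "HOL-Computational_Algebra.Formal_Power_Series"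
begin

text \<open>
  Write \<open>e = r - d\<close> and let \<open>G(X, Y)\<close> be the sum over \<open>1 \<le> d < r\<close> and \<open>m \<in> T_range r p\<close> of
  \<open>X\<^bsup>e-1\<^esup> Y\<^bsup>d-1\<^esup> / ((m\<^sub>1 - X) \<dots> (m\<^sub>e - X) (m\<^bsub>e+1\<^esub> - Y) \<dots> (m\<^sub>r - Y))\<close>. Taking the homogeneous part of
  degree \<open>w - 2\<close> at \<open>X = t\<close>, \<open>Y = z t\<close>, the claim becomes
  \<open>G(X, X + Y) + G(Y, X + Y) + G(X, -Y) \<equiv> 0\<close> modulo every odd prime \<open>p\<close>.

  Let \<open>f\<^sub>e(s)\<close> be the sum of \<open>s^(m\<^sub>e) / ((m\<^sub>1 - X) \<dots> (m\<^sub>e - X))\<close> over \<open>m\<^sub>1 < \<dots> < m\<^sub>e\<close> with \<open>m\<^sub>i \<equiv> i (mod 2)\<close>,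
  let \<open>g\<^sub>d(s)\<close> be its analogue for \<open>Y\<close>, and put \<open>\<omega> = s / (1 - s\<^sup>2)\<close>, \<open>\<theta> = s d/ds\<close>. Then
  \<open>\<theta> f\<^sub>e = X f\<^sub>e + \<omega> f\<^bsub>e-1\<^esub>\<close>. By the Leibniz rule, the sum of \<open>X\<^bsup>e-1\<^esup> Y\<^bsup>d-1\<^esup> f\<^sub>e g\<^sub>d\<close> over \<open>e + d = r\<close>
  satisfies the recursion in \<open>r\<close> that also governs the generating function of
  \<open>G(X, X + Y) + G(Y, X + Y)\<close>, so the two agree over \<open>\<rat>\<close>. Comparing coefficients of \<open>s\<^sup>p\<close> after
  multiplication by \<open>\<omega>\<close> expresses \<open>G(X, X + Y) + G(Y, X + Y)\<close> by pairs of tuples \<open>m\<close>, \<open>n\<close> with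
  \<open>m\<^sub>e + n\<^sub>d < p\<close>. Reversing \<open>n\<close> by \<open>n\<^sub>j = p - m\<^bsub>r+1-j\<^esub>\<close>, which respects the parity conditions
  because \<open>r\<close> is even and \<open>p\<close> odd, turns this modulo \<open>p\<close> into \<open>-G(X, -Y)\<close>.
\<close>

unbundle fps_syntax

subsection \<open>Generating functions of tuples with alternating parity\<close>

definition odd_fps :: "'a::comm_ring_1 fps" where
  "odd_fps = Abs_fps (\<lambda>n. if odd n then 1 else 0)"

definition weight_fps :: "(nat \<Rightarrow> 'a::comm_ring_1) \<Rightarrow> 'a fps \<Rightarrow> 'a fps" where
  "weight_fps f F = Abs_fps (\<lambda>n. f n * F $ n)"

text \<open>
  The coefficient of index \<open>n\<close> of \<open>chain \<phi> r\<close> runs over the tuples \<open>m\<^sub>1 < \<dots> < m\<^sub>r\<close> with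
  \<open>m\<^sub>i \<equiv> i (mod 2)\<close> and \<open>m\<^sub>r = n\<close>; a further factor \<open>odd_fps\<close> replaces \<open>m\<^sub>r = n\<close> by \<open>m\<^sub>r < n\<close>.
\<close>

fun chain :: "(nat \<Rightarrow> nat \<Rightarrow> 'a::comm_ring_1) \<Rightarrow> nat \<Rightarrow> 'a fps" where
  "chain \<phi> 0 = 1"
| "chain \<phi> (Suc r) = weight_fps (\<phi> r) (odd_fps * chain \<phi> r)"

text \<open>Encodes the change of weight after the first \<open>e\<close> entries; polymorphic, as
  it serves for weight functions, for the constants \<open>c\<close>, \<open>c'\<close> and for
  tuple entries.\<close>

definition glue :: "nat \<Rightarrow> 'b \<Rightarrow> 'b \<Rightarrow> nat \<Rightarrow> 'b" where
  "glue e f g = (\<lambda>i. if i < e then f else g)"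

lemma weight_fps_nth [simp]: "weight_fps f F $ n = f n * F $ n"
  by (simp add: weight_fps_def)

lemma odd_fps_nth [simp]: "odd_fps $ n = (if odd n then 1 else 0)"
  by (simp add: odd_fps_def)

lemma chain_cong: "(\<And>i. i < r \<Longrightarrow> \<phi> i = \<psi> i) \<Longrightarrow> chain \<phi> r = chain \<psi> r"
  by (induction r) auto

lemma chain_glue: "n \<le> e \<Longrightarrow> chain (glue e f g) n = chain (\<lambda>_. f) n"
  by (rule chain_cong) (auto simp: glue_def)

lemma T_range_0: "T_range 0 N = {[]}"
  by (auto simp: T_range_def)

text \<open>Splits off the last entry \<open>n\<close>; the other entries then only have to stay
  below \<open>n\<close>.\<close>

lemma T_range_Suc:
  "T_range (Suc r) N = (\<lambda>(n, m). m @ [n]) ` (SIGMA n:{n. n < N \<and> [n = Suc r] (mod 2)}. T_range r n)"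
  (is "?L = ?R")
proof (intro equalityI subsetI)
  fix l assume l: "l \<in> ?L"
  then obtain m n where mn: "l = m @ [n]" "length m = r"
    by (cases l rule: rev_cases) (auto simp: T_range_def)
  have par: "[(m @ [n]) ! (i - 1) = i] (mod 2)" if "i \<in> {1..Suc r}" for i
    using l that mn by (auto simp: T_range_def)
  have "[m ! (i - 1) = i] (mod 2)" if "i \<in> {1..r}" for i
  proof -
    have "i - 1 < length m" using that mn by auto
    thus ?thesis using par[of i] that by (simp add: nth_append)
  qed
  moreover have "[n = Suc r] (mod 2)"
    using par[of "Suc r"] nth_append_length[of m n "[]"] mn by simp
  ultimately have "(n, m) \<in> (SIGMA n:{n. n < N \<and> [n = Suc r] (mod 2)}. T_range r n)"
    using l mn by (auto simp: T_range_def sorted_wrt_append)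
  thus "l \<in> ?R" using mn by force
next
  fix l assume "l \<in> ?R"
  then obtain m n where l: "l = m @ [n]" and n: "n < N" "[n = Suc r] (mod 2)" and m: "m \<in> T_range r n"
    by auto
  have len: "length m = r" using m by (simp add: T_range_def)
  have pos: "0 < n"
  proof (cases m)
    case Nil
    thus ?thesis using n len by (cases n) (auto simp: cong_def)
  qed (use m in \<open>auto simp: T_range_def\<close>)
  have "[(m @ [n]) ! (i - 1) = i] (mod 2)" if "i \<in> {1..Suc r}" for i
  proof (cases "i = Suc r")
    case False
    hence "i \<in> {1..r}" "i - 1 < length m" using that len by auto
    thus ?thesis using m by (simp add: nth_append T_range_def)
  qed (use n len in auto)
  thus "l \<in> ?L"
    using m n pos unfolding l by (auto simp: T_range_def sorted_wrt_append)
qed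

text \<open>The factors \<open>odd_fps\<close> make consecutive gaps odd, starting from 0, hence m_i
  \<equiv> i (mod 2). The final gap N - m_r is then odd iff \<open>N + r\<close> is odd; otherwise
  the coefficient is 0.\<close>

lemma odd_fps_chain_nth:
  fixes \<phi> :: "nat \<Rightarrow> nat \<Rightarrow> 'a::comm_ring_1"
  assumes "odd (N + r)"
  shows "(odd_fps * chain \<phi> r) $ N = (\<Sum>m\<in>T_range r N. \<Prod>i<r. \<phi> i (m ! i))"
  using assms
proof (induction r arbitrary: N)
  case 0
  thus ?case by (simp add: T_range_0)
next
  case (Suc r)
  let ?A = "{n. n < N \<and> [n = Suc r] (mod 2)}"
  have par: "[n = Suc r] (mod 2) \<longleftrightarrow> odd (n + r)" for n
    by (auto simp: cong_def mod2_eq_if)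
  have "(odd_fps * chain \<phi> (Suc r)) $ N =
        (\<Sum>n=0..N. chain \<phi> (Suc r) $ n * (if odd (N - n) then 1 else 0))"
    by (subst mult.commute, subst fps_mult_nth) simp
  also have "\<dots> = (\<Sum>n\<in>?A. chain \<phi> (Suc r) $ n)"
    by (intro sum.mono_neutral_cong_right) (use Suc.prems in \<open>auto simp: par le_less\<close>)
  also have "\<dots> = (\<Sum>n\<in>?A. \<Sum>m\<in>T_range r n. (\<Prod>i<r. \<phi> i (m ! i)) * \<phi> r n)"
    by (intro sum.cong refl) (simp add: Suc.IH par sum_distrib_left mult.commute)
  also have "\<dots> = (\<Sum>(n, m)\<in>(SIGMA n:?A. T_range r n). (\<Prod>i<r. \<phi> i (m ! i)) * \<phi> r n)"
    by (rule sum.Sigma) (auto simp: finite_T_range)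
  also have "\<dots> = (\<Sum>l\<in>T_range (Suc r) N. \<Prod>i<Suc r. \<phi> i (l ! i))"
    unfolding T_range_Suc
    by (subst sum.reindex)
       (auto simp: inj_on_def T_range_def nth_append intro!: sum.cong arg_cong2[of _ _ _ _ "(*)"] prod.cong)
  finally show ?case .
qed

lemma weight_fps_reflect:
  "(weight_fps (\<lambda>m. f (p - m)) F * G) $ p = (F * weight_fps f G) $ p"
  unfolding fps_mult_nth by (intro sum.cong refl) (simp add: mult_ac)

text \<open>This is the passage from \<open>m\<^sub>i\<close> to \<open>p - m\<^sub>i\<close> for the last \<open>d\<close> entries, moved one at a time to the other factor.\<close>

lemma chain_reflect:
  "(chain (glue e f (\<lambda>m. g (p - m))) (e + d) * (odd_fps * chain (\<lambda>_. g) j)) $ p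
   = (chain (\<lambda>_. f) e * (odd_fps * chain (\<lambda>_. g) (j + d))) $ p"
proof (induction d arbitrary: j)
  case 0
  thus ?case by (simp add: chain_glue)
next
  case (Suc d)
  let ?\<phi> = "glue e f (\<lambda>m. g (p - m))"
  have \<phi>: "?\<phi> (e + d) = (\<lambda>m. g (p - m))" by (simp add: glue_def)
  have "chain ?\<phi> (e + Suc d) * (odd_fps * chain (\<lambda>_. g) j)
      = weight_fps (\<lambda>m. g (p - m)) (odd_fps * chain ?\<phi> (e + d)) * (odd_fps * chain (\<lambda>_. g) j)"
    by (simp add: \<phi>)
  also have "\<dots> $ p = (odd_fps * chain ?\<phi> (e + d) * chain (\<lambda>_. g) (Suc j)) $ p"
    unfolding weight_fps_reflect by simp
  also have "odd_fps * chain ?\<phi> (e + d) * chain (\<lambda>_. g) (Suc j)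
      = chain ?\<phi> (e + d) * (odd_fps * chain (\<lambda>_. g) (Suc j))"
    by (simp only: mult_ac)
  finally show ?case using Suc.IH[of "Suc j"] by simp
qed

section \<open>Euler operator equations and their unique solution\<close>

text \<open>
  With \<open>\<phi> r n = t / (n - c t)\<close>, chains solve a linear equation for the Euler operator
  \<open>\<theta> F = fps_X * fps_deriv F\<close>.
\<close>

lemma theta_chain:
  fixes \<phi> :: "nat \<Rightarrow> nat \<Rightarrow> 'a::comm_ring_1"
  assumes "\<And>n. n > 0 \<Longrightarrow> (of_nat n - c * t) * \<phi> r n = t"
  shows "fps_X * fps_deriv (chain \<phi> (Suc r)) =
           fps_const (c * t) * chain \<phi> (Suc r) + fps_const t * (odd_fps * chain \<phi> r)"
proof (rule fps_ext)
  fix n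
  let ?F = "(odd_fps * chain \<phi> r) $ n"
  have "of_nat n * (\<phi> r n * ?F) = c * t * (\<phi> r n * ?F) + t * ?F"
  \<comment> \<open>At index 0, where \<open>\<phi> r\<close> is unconstrained, \<open>?F\<close>
    vanishes because \<open>odd_fps\<close> has no constant term.\<close>
  proof (cases "n = 0")
    case False
    have "t * ?F = ((of_nat n - c * t) * \<phi> r n) * ?F"
      using assms False by simp
    thus ?thesis by (simp add: algebra_simps)
  qed simp
  thus "(fps_X * fps_deriv (chain \<phi> (Suc r))) $ n =
    (fps_const (c * t) * chain \<phi> (Suc r) + fps_const t * (odd_fps * chain \<phi> r)) $ n"
    by (cases n) (simp_all add: mult.assoc)
qed

text \<open>Coefficient n satisfies (n - c) F_n = B_n for n > 0, so only the constant term is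
  free.\<close>

lemma theta_unique:
  fixes F G :: "'a::idom fps"
  assumes "fps_X * fps_deriv F = fps_const c * F + B" "fps_X * fps_deriv G = fps_const c * G + B"
    and "F $ 0 = G $ 0" and nz: "\<And>n. n > 0 \<Longrightarrow> of_nat n \<noteq> c"
  shows "F = G"
proof (rule fps_ext)
  fix n
  show "F $ n = G $ n"
  proof (cases n)
    case (Suc m)
    have "(fps_X * fps_deriv F) $ n - c * F $ n = (fps_X * fps_deriv G) $ n - c * G $ n"
      unfolding assms(1,2) by simp
    hence "(of_nat n - c) * F $ n = (of_nat n - c) * G $ n"
      by (simp add: Suc algebra_simps)
    thus ?thesis using nz[of n] Suc by simp
  qed (use assms in simp)
qed

text \<open>With weights t/(m - x t) and t/(m - y t) this is t^2 times the sum of X^(e-1) Y^(d-1)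
  f_e g_d over e + d = n + 2, at X = x t, Y = y t; here e = i + 1.\<close>

definition conv_sum :: "'a::comm_ring_1 \<Rightarrow> 'a \<Rightarrow> (nat \<Rightarrow> 'a) \<Rightarrow> (nat \<Rightarrow> 'a) \<Rightarrow> nat \<Rightarrow> 'a fps" where
  "conv_sum x y f g n =
     (\<Sum>i\<le>n. fps_const (x ^ i * y ^ (n - i)) * (chain (\<lambda>_. f) (Suc i) * chain (\<lambda>_. g) (Suc (n - i))))"

definition glue_sum :: "'a::comm_ring_1 \<Rightarrow> 'a \<Rightarrow> (nat \<Rightarrow> 'a) \<Rightarrow> (nat \<Rightarrow> 'a) \<Rightarrow> nat \<Rightarrow> 'a fps" where
  "glue_sum x y f g n =
     (\<Sum>i\<le>n. fps_const (x ^ i * y ^ (n - i)) * chain (glue (Suc i) f g) (Suc (Suc n)))"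

lemma theta_sum: "fps_X * fps_deriv (\<Sum>i\<in>A. fps_const (c i) * F i) =
    (\<Sum>i\<in>A. fps_const (c i) * (fps_X * fps_deriv (F i :: 'a::comm_ring_1 fps)))"
  by (simp add: fps_deriv_sum sum_distrib_left mult_ac)

lemma theta_mult: "fps_X * fps_deriv (F * G :: 'a::comm_ring_1 fps) =
   (fps_X * fps_deriv F) * G + F * (fps_X * fps_deriv G)"
  by (simp add: algebra_simps)

text \<open>Only the last weight enters \<theta>, and it is \<open>g\<close> in every summand.
  Removing the last entry leaves a pure \<open>f\<close>-chain for \<open>i = n\<close>, and
  \<open>y\<close> times a summand of the shorter sum for \<open>i < n\<close>.\<close>

lemma theta_glue_sum:
  fixes f g :: "nat \<Rightarrow> 'a::comm_ring_1"
  assumes "\<And>n. n > 0 \<Longrightarrow> (of_nat n - y * t) * g n = t"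
  shows "fps_X * fps_deriv (glue_sum x y f g n) = fps_const (y * t) * glue_sum x y f g n +
     fps_const t * odd_fps * (fps_const (x ^ n) * chain (\<lambda>_. f) (Suc n) +
        (case n of 0 \<Rightarrow> 0 | Suc m \<Rightarrow> fps_const y * glue_sum x y f g m))"
proof -
  have *: "fps_X * fps_deriv (chain (glue (Suc i) f g) (Suc (Suc n))) =
     fps_const (y * t) * chain (glue (Suc i) f g) (Suc (Suc n)) +
     fps_const t * (odd_fps * chain (glue (Suc i) f g) (Suc n))" if "i \<le> n" for i
    by (rule theta_chain) (use assms that in \<open>auto simp: glue_def\<close>)
  have "fps_X * fps_deriv (glue_sum x y f g n) = fps_const (y * t) * glue_sum x y f g n +
     fps_const t * odd_fps * (\<Sum>i\<le>n. fps_const (x ^ i * y ^ (n - i)) * chain (glue (Suc i) f g) (Suc n))"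
    unfolding glue_sum_def theta_sum sum_distrib_left
    by (subst sum.distrib[symmetric], rule sum.cong[OF refl])
       (simp only: atMost_iff * algebra_simps)
  also have "(\<Sum>i\<le>n. fps_const (x ^ i * y ^ (n - i)) * chain (glue (Suc i) f g) (Suc n))
    = fps_const (x ^ n) * chain (\<lambda>_. f) (Suc n) +
        (case n of 0 \<Rightarrow> 0 | Suc m \<Rightarrow> fps_const y * glue_sum x y f g m)"
  proof (cases n)
    case 0
    thus ?thesis by (simp add: chain_glue del: chain.simps)
  next
    case (Suc m)
    have "(\<Sum>i\<le>m. fps_const (x ^ i * y ^ (n - i)) * chain (glue (Suc i) f g) (Suc n))
      = fps_const y * glue_sum x y f g m"
      unfolding glue_sum_def sum_distrib_left Suc
      by (intro sum.cong refl)
         (simp add: Suc_diff_le fps_const_mult[symmetric] mult_ac del: chain.simps fps_const_mult)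
    thus ?thesis by (simp add: Suc chain_glue del: chain.simps)
  qed
  finally show ?thesis .
qed

text \<open>By the Leibniz rule, \<open>?S1\<close> shortens the \<open>f\<close>-chain and
  \<open>?S2\<close> the \<open>g\<close>-chain. A chain of length 1 disappears, leaving a pure
  term; the other summands form \<open>x\<close> resp. \<open>y\<close> times the shorter
  sum.\<close>

lemma theta_conv_sum:
  fixes f g :: "nat \<Rightarrow> 'a::comm_ring_1"
  assumes f: "\<And>n. n > 0 \<Longrightarrow> (of_nat n - x * t) * f n = t"
    and g: "\<And>n. n > 0 \<Longrightarrow> (of_nat n - y * t) * g n = t"
  shows "fps_X * fps_deriv (conv_sum x y f g n) = fps_const ((x + y) * t) * conv_sum x y f g n +
     fps_const t * odd_fps * (fps_const (x ^ n) * chain (\<lambda>_. f) (Suc n) + fps_const (y ^ n) * chain (\<lambda>_. g) (Suc n) +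
        (case n of 0 \<Rightarrow> 0 | Suc m \<Rightarrow> fps_const (x + y) * conv_sum x y f g m))"
proof -
  let ?f = "chain (\<lambda>_. f)" and ?g = "chain (\<lambda>_. g)"
  have tf: "fps_X * fps_deriv (?f (Suc i)) =
     fps_const (x * t) * ?f (Suc i) + fps_const t * (odd_fps * ?f i)" for i
    by (rule theta_chain) (use f in auto)
  have tg: "fps_X * fps_deriv (?g (Suc i)) =
     fps_const (y * t) * ?g (Suc i) + fps_const t * (odd_fps * ?g i)" for i
    by (rule theta_chain) (use g in auto)
  have tfg: "fps_X * fps_deriv (?f (Suc i) * ?g (Suc j)) =
     fps_const ((x + y) * t) * (?f (Suc i) * ?g (Suc j)) +
     fps_const t * odd_fps * (?f i * ?g (Suc j) + ?f (Suc i) * ?g j)" for i j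
    unfolding theta_mult tf tg
    by (simp add: algebra_simps flip: fps_const_add fps_const_mult del: chain.simps fps_const_add fps_const_mult)
  let ?S1 = "\<Sum>i\<le>n. fps_const (x ^ i * y ^ (n - i)) * (?f i * ?g (Suc (n - i)))"
  let ?S2 = "\<Sum>i\<le>n. fps_const (x ^ i * y ^ (n - i)) * (?f (Suc i) * ?g (n - i))"
  have "fps_X * fps_deriv (conv_sum x y f g n) = fps_const ((x + y) * t) * conv_sum x y f g n +
     fps_const t * odd_fps * (?S1 + ?S2)"
    unfolding conv_sum_def theta_sum tfg
    by (simp add: sum_distrib_left distrib_left sum.distrib mult_ac del: chain.simps fps_const_add fps_const_mult)
  also have "?S1 = fps_const (y ^ n) * ?g (Suc n) +
      (case n of 0 \<Rightarrow> 0 | Suc m \<Rightarrow> fps_const x * conv_sum x y f g m)"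
  proof (cases n)
    case (Suc m)
    show ?thesis unfolding Suc conv_sum_def sum_distrib_left
      by (subst sum.atMost_Suc_shift)
         (simp add: mult_ac del: chain.simps(2) fps_const_mult flip: fps_const_mult)
  qed (simp del: chain.simps(2))
  also have "?S2 = fps_const (x ^ n) * ?f (Suc n) +
      (case n of 0 \<Rightarrow> 0 | Suc m \<Rightarrow> fps_const y * conv_sum x y f g m)"
  proof (cases n)
    case (Suc m)
    have "(\<Sum>i\<le>m. fps_const (x ^ i * y ^ (Suc m - i)) * (?f (Suc i) * ?g (Suc m - i)))
      = fps_const y * conv_sum x y f g m"
      unfolding conv_sum_def sum_distrib_left
      by (intro sum.cong refl)
         (simp add: Suc_diff_le mult_ac del: chain.simps fps_const_mult flip: fps_const_mult)
    thus ?thesis by (simp add: Suc del: chain.simps(2))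
  qed (simp del: chain.simps(2))
  finally show ?thesis
    by (cases n) (simp_all add: algebra_simps del: chain.simps fps_const_add fps_const_mult flip: fps_const_add)
qed

lemma sum_nth_0: "conv_sum x y f g n $ 0 = 0" "glue_sum x y f g n $ 0 = 0"
  by (simp_all add: conv_sum_def glue_sum_def fps_sum_nth)

text \<open>Both sides have constant term 0 and solve the same \<theta>-equation, the inhomogeneous
  parts being equal by induction.\<close>

lemma conv_sum_eq_glue_sum:
  fixes f g h :: "nat \<Rightarrow> 'a::idom"
  assumes f: "\<And>n. n > 0 \<Longrightarrow> (of_nat n - x * t) * f n = t"
    and g: "\<And>n. n > 0 \<Longrightarrow> (of_nat n - y * t) * g n = t"
    and h: "\<And>n. n > 0 \<Longrightarrow> (of_nat n - (x + y) * t) * h n = t"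
    and "t \<noteq> 0"
  shows "conv_sum x y f g n = glue_sum x (x + y) f h n + glue_sum y (x + y) g h n"
proof -
  have tg: "fps_X * fps_deriv (glue_sum x' (x + y) f' h n) = fps_const ((x + y) * t) * glue_sum x' (x + y) f' h n +
     fps_const t * odd_fps * (fps_const (x' ^ n) * chain (\<lambda>_. f') (Suc n) +
        (case n of 0 \<Rightarrow> 0 | Suc m \<Rightarrow> fps_const (x + y) * glue_sum x' (x + y) f' h m))" for x' f' n
    by (rule theta_glue_sum) (rule h)
  show ?thesis
  proof (induction n)
    case 0
    show ?case
    proof (rule theta_unique[OF theta_conv_sum[OF f g]])
      show "fps_X * fps_deriv (glue_sum x (x + y) f h 0 + glue_sum y (x + y) g h 0) =
        fps_const ((x + y) * t) * (glue_sum x (x + y) f h 0 + glue_sum y (x + y) g h 0) +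
        fps_const t * odd_fps * (fps_const (x ^ 0) * chain (\<lambda>_. f) (Suc 0) + fps_const (y ^ 0) * chain (\<lambda>_. g) (Suc 0) +
          (case 0 of 0 \<Rightarrow> 0 | Suc m \<Rightarrow> fps_const (x + y) * conv_sum x y f g m))"
        unfolding fps_deriv_add distrib_left tg
        by (simp only: nat.case power_0 algebra_simps add_0_right add_0_left mult_zero_right mult_zero_left)
      \<comment> \<open>Otherwise \<open>h\<close> would give 0 = t.\<close>
      show "of_nat n \<noteq> (x + y) * t" if "n > 0" for n
        using h[OF that] \<open>t \<noteq> 0\<close> by auto
    qed (simp_all add: sum_nth_0)
  next
    case (Suc n)
    show ?case
    proof (rule theta_unique[OF theta_conv_sum[OF f g]])
      show "fps_X * fps_deriv (glue_sum x (x + y) f h (Suc n) + glue_sum y (x + y) g h (Suc n)) =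
        fps_const ((x + y) * t) * (glue_sum x (x + y) f h (Suc n) + glue_sum y (x + y) g h (Suc n)) +
        fps_const t * odd_fps * (fps_const (x ^ Suc n) * chain (\<lambda>_. f) (Suc (Suc n)) + fps_const (y ^ Suc n) * chain (\<lambda>_. g) (Suc (Suc n)) +
          (case Suc n of 0 \<Rightarrow> 0 | Suc m \<Rightarrow> fps_const (x + y) * conv_sum x y f g m))"
        unfolding fps_deriv_add distrib_left tg nat.case Suc.IH
        by (simp only: algebra_simps)
      show "of_nat n \<noteq> (x + y) * t" if "n > 0" for n
        using h[OF that] \<open>t \<noteq> 0\<close> by auto
    qed (simp_all add: sum_nth_0)
  qed
qed

subsection \<open>Extraction of the part of weight \<open>w\<close>\<close>

text \<open>\<open>natpermute\<close> also admits zero parts, but these meet a vanishing constant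
  term.\<close>

lemma fps_prod_nth_indices:
  fixes a :: "nat \<Rightarrow> 'a::comm_ring_1 fps"
  assumes "\<And>i. i < r \<Longrightarrow> a i $ 0 = 0" and "r > 0"
  shows "(\<Prod>i<r. a i) $ w = (\<Sum>k\<in>indices r w. \<Prod>i<r. a i $ (k ! i))"
proof -
  obtain m where r: "r = Suc m" using \<open>r > 0\<close> by (cases r) auto
  have eq: "{..<r} = {0..m}" using r by auto
  have "(\<Prod>i<r. a i) $ w = (\<Sum>k\<in>natpermute w r. \<Prod>i<r. a i $ (k ! i))"
    unfolding eq using fps_prod_nth[of a m w] by (simp only: r Suc_eq_plus1)
  also have "\<dots> = (\<Sum>k\<in>indices r w. \<Prod>i<r. a i $ (k ! i))"
  proof (intro sum.mono_neutral_right natpermute_finite ballI)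
    fix k assume k: "k \<in> natpermute w r - indices r w"
    then obtain i where "i < r" "k ! i = 0"
      by (auto simp: natpermute_def indices_def in_set_conv_nth)
    thus "(\<Prod>i<r. a i $ (k ! i)) = 0"
      by (intro prod_zero) (auto intro!: bexI[of _ i] simp: assms)
  qed (auto simp: natpermute_def indices_def)
  finally show ?thesis .
qed

text \<open>\<open>geo c u\<close> is \<open>t / (1/u - c t)\<close> as a power series in \<open>t\<close>.\<close>

definition geo :: "'a::comm_ring_1 \<Rightarrow> 'a \<Rightarrow> 'a fps" where
  "geo c u = Abs_fps (\<lambda>k. if k = 0 then 0 else c ^ (k - 1) * u ^ k)"

lemma geo_nth: "geo c u $ k = (if k = 0 then 0 else c ^ (k - 1) * u ^ k)"
  by (simp add: geo_def)

lemma geo_equation: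
  assumes "a * u = 1"
  shows "(fps_const a - fps_const c * fps_X) * geo c u = fps_X"
proof (rule fps_ext)
  fix n
  have "a * (u * b) = b" for b
    using assms by (simp flip: mult.assoc)
  hence *: "a * (u * b) = b" "a * (c * (u * b)) = c * b" for b
    by (simp_all add: mult.left_commute[of a c])
  have "((fps_const a - fps_const c * fps_X) * geo c u) $ n = a * geo c u $ n - c * (fps_X * geo c u) $ n"
    by (simp add: left_diff_distrib mult.assoc)
  also have "\<dots> = fps_X $ n"
  proof (cases n)
    case (Suc m)
    thus ?thesis using assms by (cases m) (simp_all add: geo_nth * mult_ac)
  qed (simp add: geo_nth)
  finally show "((fps_const a - fps_const c * fps_X) * geo c u) $ n = fps_X $ n" .
qed

text \<open>The prefactors X^(e-1) and Y^(d-1) supply the |I| - 1 missing powers, so that each block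
  ends up with its weight minus 1 as exponent.\<close>

lemma power_collect:
  fixes c :: "'a::comm_monoid_mult" and k :: "nat \<Rightarrow> nat"
  assumes "\<And>i. i \<in> I \<Longrightarrow> 0 < k i" "finite I" "I \<noteq> {}"
  shows "c ^ (card I - 1) * (\<Prod>i\<in>I. c ^ (k i - 1)) = c ^ (sum k I - 1)"
proof -
  have "sum k I = (\<Sum>i\<in>I. (k i - 1) + 1)"
    by (intro sum.cong refl) (use assms(1) in force)
  also have "\<dots> = (\<Sum>i\<in>I. k i - 1) + card I"
    by (subst sum.distrib) simp
  moreover have "card I > 0" using assms by (simp add: card_gt_0_iff)
  ultimately have "sum k I - 1 = (card I - 1) + (\<Sum>i\<in>I. k i - 1)" by simp
  thus ?thesis by (simp add: power_add power_sum)
qed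

lemma last_weight_eq_sum:
  assumes "length k = e + d"
  shows "last_weight d k = (\<Sum>i\<in>{e..<e + d}. k ! i)"
proof -
  have "last_weight d k = (\<Sum>i<d. k ! (e + i))"
    unfolding last_weight_def by (simp add: sum_list_sum_nth assms atLeast0LessThan)
  also have "\<dots> = (\<Sum>i\<in>{e..<e + d}. k ! i)"
    by (rule sum.reindex_bij_witness[of _ "\<lambda>i. i - e" "\<lambda>i. e + i"]) auto
  finally show ?thesis .
qed

lemma prod_geo_nth:
  fixes c c' :: "'a::comm_ring_1"
  assumes "e > 0" "d > 0" and r: "r = e + d"
  shows "(fps_const (c ^ (e - 1) * c' ^ (d - 1)) * (\<Prod>i<r. geo (glue e c c' i) (u i))) $ w =
    (\<Sum>k\<in>indices r w. c ^ (w - last_weight d k - 1) * c' ^ (last_weight d k - 1) * (\<Prod>i<r. u i ^ (k ! i)))"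
proof -
  have split: "{..<r} = {..<e} \<union> {e..<r}" "{..<e} \<inter> {e..<r} = {}" using r by auto
  have "c ^ (e - 1) * c' ^ (d - 1) * (\<Prod>i<r. geo (glue e c c' i) (u i) $ (k ! i)) =
      c ^ (w - last_weight d k - 1) * c' ^ (last_weight d k - 1) * (\<Prod>i<r. u i ^ (k ! i))"
    if k: "k \<in> indices r w" for k
  proof -
    have pos: "0 < k ! i" if "i < r" for i
      using k that by (auto simp: indices_def)
    have len: "length k = r" and w: "w = sum_list k" using k by (auto simp: indices_def)
    have lw: "last_weight d k = (\<Sum>i\<in>{e..<r}. k ! i)"
      using last_weight_eq_sum[of k e d] len r by simp
    have "w = (\<Sum>i<r. k ! i)" by (simp add: w sum_list_sum_nth len atLeast0LessThan)
    hence fw: "w - last_weight d k = (\<Sum>i<e. k ! i)"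
      unfolding lw split(1) by (subst (asm) sum.union_disjoint) (auto simp: split)
    have 1: "c ^ (e - 1) * (\<Prod>i<e. c ^ (k ! i - 1)) = c ^ (w - last_weight d k - 1)"
      unfolding fw using power_collect[of "{..<e}" "\<lambda>i. k ! i" c] assms pos by auto
    have 2: "c' ^ (d - 1) * (\<Prod>i\<in>{e..<r}. c' ^ (k ! i - 1)) = c' ^ (last_weight d k - 1)"
      unfolding lw using power_collect[of "{e..<r}" "\<lambda>i. k ! i" c'] assms pos by auto
    have "(\<Prod>i<r. geo (glue e c c' i) (u i) $ (k ! i)) =
        (\<Prod>i<r. glue e c c' i ^ (k ! i - 1)) * (\<Prod>i<r. u i ^ (k ! i))"
      unfolding prod.distrib[symmetric]
      by (intro prod.cong refl) (use pos in \<open>force simp: geo_nth\<close>)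
    also have "(\<Prod>i<r. glue e c c' i ^ (k ! i - 1)) =
        (\<Prod>i<e. c ^ (k ! i - 1)) * (\<Prod>i\<in>{e..<r}. c' ^ (k ! i - 1))"
      unfolding split(1) by (subst prod.union_disjoint) (auto simp: glue_def)
    finally show ?thesis by (simp only: 1[symmetric] 2[symmetric] mult_ac)
  qed
  thus ?thesis
    using assms by (simp add: fps_prod_nth_indices geo_nth sum_distrib_left)
qed

text \<open>The reciprocals are a position-dependent parameter \<open>v\<close>, so that trailing
  entries may enter as 1/(p - m).\<close>

definition T_sum :: "(nat \<Rightarrow> nat \<Rightarrow> 'a::comm_ring_1) \<Rightarrow> nat list \<Rightarrow> nat \<Rightarrow> 'a" where
  "T_sum v k p = (\<Sum>m\<in>T_range (length k) p. \<Prod>i<length k. v i (m ! i) ^ (k ! i))"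

lemma sum_T_range_geo_nth:
  fixes c c' :: "'a::comm_ring_1"
  assumes "e > 0" "d > 0" and r: "r = e + d"
  shows "(fps_const (c ^ (e - 1) * c' ^ (d - 1)) *
      (\<Sum>m\<in>T_range r p. \<Prod>i<r. geo (glue e c c' i) (v i (m ! i)))) $ w =
    (\<Sum>k\<in>indices r w. c ^ (w - last_weight d k - 1) * c' ^ (last_weight d k - 1) * T_sum v k p)"
proof -
  have "T_sum v k p = (\<Sum>m\<in>T_range r p. \<Prod>i<r. v i (m ! i) ^ (k ! i))" if "k \<in> indices r w" for k
    using that by (simp add: T_sum_def indices_def)
  hence "(\<Sum>k\<in>indices r w. c ^ (w - last_weight d k - 1) * c' ^ (last_weight d k - 1) * T_sum v k p) =
      (\<Sum>m\<in>T_range r p. \<Sum>k\<in>indices r w. c ^ (w - last_weight d k - 1) * c' ^ (last_weight d k - 1) *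
         (\<Prod>i<r. v i (m ! i) ^ (k ! i)))"
    by (subst sum.swap) (simp add: sum_distrib_left)
  thus ?thesis
    unfolding sum_distrib_left fps_sum_nth
    by (simp only: prod_geo_nth[OF assms])
qed

text \<open>A constant polynomial, since the ground ring has to contain z as well.\<close>

definition recip :: "nat \<Rightarrow> rat poly" where
  "recip m = [:inverse (of_nat m):]"

text \<open>Index \<open>p\<close> imposes m_r < p and index \<open>w\<close> fixes the weight;
  summand \<open>i\<close> corresponds to d = n + 1 - i.\<close>

lemma sum_glue_sum_nth:
  fixes c c' :: "'a::comm_ring_1" and u :: "nat \<Rightarrow> 'a"
  assumes "odd p" "even n"
  shows "(odd_fps * glue_sum (fps_const c) (fps_const c') (\<lambda>m. geo c (u m)) (\<lambda>m. geo c' (u m)) n) $ p $ w =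
    (\<Sum>k\<in>indices (n + 2) w. \<Sum>d=1..n+1.
       c ^ (w - last_weight d k - 1) * c' ^ (last_weight d k - 1) * T_sum (\<lambda>_. u) k p)"
proof -
  let ?f = "\<lambda>m. geo c (u m)" and ?g = "\<lambda>m. geo c' (u m)"
  have par: "odd (p + (n + 2))" using assms by simp
  have "(odd_fps * (fps_const (fps_const c ^ i * fps_const c' ^ (n - i)) * chain (glue (Suc i) ?f ?g) (n + 2))) $ p $ w
    = (\<Sum>k\<in>indices (n + 2) w. c ^ (w - last_weight (n + 1 - i) k - 1) *
          c' ^ (last_weight (n + 1 - i) k - 1) * T_sum (\<lambda>_. u) k p)" if "i \<le> n" for i
  proof -
    have "(odd_fps * (fps_const (fps_const c ^ i * fps_const c' ^ (n - i)) * chain (glue (Suc i) ?f ?g) (n + 2))) $ p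
      = fps_const (c ^ i * c' ^ (n - i)) * (odd_fps * chain (glue (Suc i) ?f ?g) (n + 2)) $ p"
      by (simp add: mult.left_commute[of odd_fps] del: chain.simps)
    also have "(odd_fps * chain (glue (Suc i) ?f ?g) (n + 2)) $ p =
        (\<Sum>m\<in>T_range (n + 2) p. \<Prod>j<n + 2. geo (glue (Suc i) c c' j) (u (m ! j)))"
      unfolding odd_fps_chain_nth[OF par] by (intro sum.cong prod.cong refl) (simp add: glue_def)
    finally show ?thesis
      using sum_T_range_geo_nth[of "Suc i" "n + 1 - i" "n + 2" c c' "\<lambda>_. u" p w] that by simp
  qed
  hence "(odd_fps * glue_sum (fps_const c) (fps_const c') ?f ?g n) $ p $ w =
    (\<Sum>i\<le>n. \<Sum>k\<in>indices (n + 2) w. c ^ (w - last_weight (n + 1 - i) k - 1) *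
          c' ^ (last_weight (n + 1 - i) k - 1) * T_sum (\<lambda>_. u) k p)"
    unfolding glue_sum_def sum_distrib_left fps_sum_nth by simp
  also have "\<dots> = (\<Sum>d=1..n+1. \<Sum>k\<in>indices (n + 2) w. c ^ (w - last_weight d k - 1) *
          c' ^ (last_weight d k - 1) * T_sum (\<lambda>_. u) k p)"
    by (rule sum.reindex_bij_witness[of _ "\<lambda>d. n + 1 - d" "\<lambda>i. n + 1 - i"]) auto
  finally show ?thesis by (subst sum.swap)
qed

lemma sum_conv_sum_nth:
  fixes c c' :: "'a::comm_ring_1" and u :: "nat \<Rightarrow> 'a"
  assumes "odd p" "even n"
  shows "(odd_fps * conv_sum (fps_const c) (fps_const c') (\<lambda>m. geo c (u m)) (\<lambda>m. geo c' (u m)) n) $ p $ w =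
    (\<Sum>k\<in>indices (n + 2) w. \<Sum>d=1..n+1.
       c ^ (w - last_weight d k - 1) * c' ^ (last_weight d k - 1) *
       T_sum (glue (n + 2 - d) u (\<lambda>m. u (p - m))) k p)"
proof -
  let ?f = "\<lambda>m. geo c (u m)" and ?g = "\<lambda>m. geo c' (u m)"
  have par: "odd (p + (n + 2))" using assms by simp
  let ?v = "\<lambda>d. glue (n + 2 - d) u (\<lambda>m. u (p - m))"
  have "(odd_fps * (fps_const (fps_const c ^ i * fps_const c' ^ (n - i)) *
          (chain (\<lambda>_. ?f) (Suc i) * chain (\<lambda>_. ?g) (Suc (n - i))))) $ p $ w
    = (\<Sum>k\<in>indices (n + 2) w. c ^ (w - last_weight (n + 1 - i) k - 1) *
          c' ^ (last_weight (n + 1 - i) k - 1) * T_sum (?v (n + 1 - i)) k p)" if "i \<le> n" for i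
  proof -
    have "(odd_fps * (fps_const (fps_const c ^ i * fps_const c' ^ (n - i)) *
          (chain (\<lambda>_. ?f) (Suc i) * chain (\<lambda>_. ?g) (Suc (n - i))))) $ p
      = fps_const (c ^ i * c' ^ (n - i)) * (chain (\<lambda>_. ?f) (Suc i) * (odd_fps * chain (\<lambda>_. ?g) (Suc (n - i)))) $ p"
      by (simp add: mult.left_commute[of odd_fps] del: chain.simps)
    also have "(chain (\<lambda>_. ?f) (Suc i) * (odd_fps * chain (\<lambda>_. ?g) (Suc (n - i)))) $ p =
        (odd_fps * chain (glue (Suc i) ?f (\<lambda>m. ?g (p - m))) (n + 2)) $ p"
      \<comment> \<open>With \<open>j = 0\<close> the second chain becomes the reflected last
        entries of a single tuple; this is still an exact identity.\<close>
      using chain_reflect[of "Suc i" ?f ?g p "Suc (n - i)" 0] that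
      by (simp add: mult.commute del: chain.simps(2))
    also have "\<dots> = (\<Sum>m\<in>T_range (n + 2) p. \<Prod>j<n + 2. geo (glue (Suc i) c c' j) (?v (n + 1 - i) j (m ! j)))"
      unfolding odd_fps_chain_nth[OF par] by (intro sum.cong prod.cong refl) (use that in \<open>simp add: glue_def\<close>)
    finally show ?thesis
      using sum_T_range_geo_nth[of "Suc i" "n + 1 - i" "n + 2" c c' "?v (n + 1 - i)" p w] that by simp
  qed
  hence "(odd_fps * conv_sum (fps_const c) (fps_const c') ?f ?g n) $ p $ w =
    (\<Sum>i\<le>n. \<Sum>k\<in>indices (n + 2) w. c ^ (w - last_weight (n + 1 - i) k - 1) *
          c' ^ (last_weight (n + 1 - i) k - 1) * T_sum (?v (n + 1 - i)) k p)"
    unfolding conv_sum_def sum_distrib_left fps_sum_nth by simp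
  also have "\<dots> = (\<Sum>d=1..n+1. \<Sum>k\<in>indices (n + 2) w. c ^ (w - last_weight d k - 1) *
          c' ^ (last_weight d k - 1) * T_sum (?v d) k p)"
    by (rule sum.reindex_bij_witness[of _ "\<lambda>d. n + 1 - d" "\<lambda>i. n + 1 - i"]) auto
  finally show ?thesis by (subst sum.swap)
qed

text \<open>The case x = 1, y = z, t = \<open>fps_X\<close>. With W the last weight, the two glued
  sums contribute (1 + z)^(W-1) and (1 + z)^(W-1) z^(w-W-1), the product side z^(W-1).\<close>

lemma weighted_sum_exact:
  fixes z :: "rat poly"
  assumes "odd p" "even r" "r \<ge> 2"
  shows "(\<Sum>k\<in>indices r w. \<Sum>d=1..r-1.
       z ^ (last_weight d k - 1) * T_sum (glue (r - d) recip (\<lambda>m. recip (p - m))) k p) =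
    (\<Sum>k\<in>indices r w. \<Sum>d=1..r-1.
       (1 + z) ^ (last_weight d k - 1) * (1 + z ^ (w - last_weight d k - 1)) * T_sum (\<lambda>_. recip) k p)"
proof -
  define n where "n = r - 2"
  have r: "r = n + 2" "r - 1 = n + 1" and n: "even n" using assms by (auto simp: n_def)
  have geo: "(of_nat m - fps_const c * fps_X) * geo c (recip m) = fps_X" if "m > 0" for m c
  proof -
    have "of_nat m * recip m = 1" using that by (simp add: recip_def of_nat_poly)
    from geo_equation[OF this, of c] show ?thesis by (simp add: fps_of_nat)
  qed
  have "conv_sum (fps_const 1) (fps_const z) (\<lambda>m. geo 1 (recip m)) (\<lambda>m. geo z (recip m)) n =
     glue_sum (fps_const 1) (fps_const 1 + fps_const z) (\<lambda>m. geo 1 (recip m)) (\<lambda>m. geo (1 + z) (recip m)) n +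
     glue_sum (fps_const z) (fps_const 1 + fps_const z) (\<lambda>m. geo z (recip m)) (\<lambda>m. geo (1 + z) (recip m)) n"
    by (rule conv_sum_eq_glue_sum[of _ fps_X]) (use geo in \<open>simp_all add: fps_const_add del: fps_const_1_eq_1\<close>)
  hence "(odd_fps * conv_sum (fps_const 1) (fps_const z) (\<lambda>m. geo 1 (recip m)) (\<lambda>m. geo z (recip m)) n) $ p $ w =
     (odd_fps * glue_sum (fps_const 1) (fps_const (1 + z)) (\<lambda>m. geo 1 (recip m)) (\<lambda>m. geo (1 + z) (recip m)) n) $ p $ w +
     (odd_fps * glue_sum (fps_const z) (fps_const (1 + z)) (\<lambda>m. geo z (recip m)) (\<lambda>m. geo (1 + z) (recip m)) n) $ p $ w"
    by (simp only: distrib_left fps_add_nth fps_const_add)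
  thus ?thesis
    unfolding sum_conv_sum_nth[OF assms(1) n] sum_glue_sum_nth[OF assms(1) n] r
    by (simp add: sum.distrib[symmetric] algebra_simps)
qed

subsection \<open>Reduction modulo \<open>p\<close>\<close>

text \<open>\<open>rat_cong p x a\<close> says that \<open>x\<close> is \<open>p\<close>-integral with residue \<open>a\<close>.\<close>

definition rat_cong :: "int \<Rightarrow> rat \<Rightarrow> int \<Rightarrow> bool" where
  "rat_cong p x a \<longleftrightarrow> (\<exists>u b. coprime b p \<and> (x - of_int a) * of_int b = of_int (p * u))"

lemma rat_cong_of_int: "rat_cong p (of_int a) a"
  unfolding rat_cong_def by (intro exI[of _ 0] exI[of _ 1]) simp

lemma rat_cong_add:
  assumes "rat_cong p x a" "rat_cong p y b"
  shows "rat_cong p (x + y) (a + b)"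
proof -
  obtain u s v t where u: "coprime s p" "(x - of_int a) * of_int s = of_int (p * u)"
    and v: "coprime t p" "(y - of_int b) * of_int t = of_int (p * v)"
    using assms by (auto simp: rat_cong_def)
  have "(x + y - of_int (a + b)) * of_int (s * t) =
      (x - of_int a) * of_int s * of_int t + (y - of_int b) * of_int t * of_int s"
    by (simp add: algebra_simps)
  also have "\<dots> = of_int (p * (u * t + v * s))"
    unfolding u v by (simp add: algebra_simps)
  finally show ?thesis
    using u(1) v(1) unfolding rat_cong_def by (metis coprime_mult_left_iff)
qed

lemma rat_cong_mult:
  assumes "rat_cong p x a" "rat_cong p y b"
  shows "rat_cong p (x * y) (a * b)"
proof -
  obtain u s v t where u: "coprime s p" "(x - of_int a) * of_int s = of_int (p * u)"
    and v: "coprime t p" "(y - of_int b) * of_int t = of_int (p * v)"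
    using assms by (auto simp: rat_cong_def)
  have "(x * y - of_int (a * b)) * of_int (s * t) =
      ((x - of_int a) * of_int s) * ((y - of_int b) * of_int t) +
      (x - of_int a) * of_int s * of_int (b * t) + (y - of_int b) * of_int t * of_int (a * s)"
    by (simp add: algebra_simps)
  also have "\<dots> = of_int (p * (u * p * v + u * b * t + v * a * s))"
    unfolding u v by (simp add: algebra_simps)
  finally show ?thesis
    using u(1) v(1) unfolding rat_cong_def by (metis coprime_mult_left_iff)
qed

lemma rat_cong_diff:
  assumes "rat_cong p x a" "rat_cong p y b"
  shows "rat_cong p (x - y) (a - b)"
  using rat_cong_add[OF assms(1) rat_cong_mult[OF rat_cong_of_int[of p "-1"] assms(2)]] by simp

lemma rat_cong_sum:
  "(\<And>i. i \<in> A \<Longrightarrow> rat_cong p (f i) (g i)) \<Longrightarrow> rat_cong p (sum f A) (sum g A)"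
  by (induction A rule: infinite_finite_induct)
     (auto intro: rat_cong_add simp: rat_cong_of_int[of p 0, simplified])

lemma rat_cong_0:
  assumes "rat_cong p 0 a"
  shows "p dvd a"
proof -
  obtain u b where "coprime b p" and "of_int (- (a * b)) = (of_int (p * u) :: rat)"
    using assms by (auto simp: rat_cong_def)
  hence "- (a * b) = p * u" by (simp only: of_int_eq_iff)
  hence "p dvd a * b" by (metis dvd_minus_iff dvd_triv_left)
  thus ?thesis using \<open>coprime b p\<close> by (simp add: coprime_commute coprime_dvd_mult_left_iff)
qed

lemma rat_cong_inverse:
  assumes "[n * a = 1] (mod p)" "n \<noteq> 0"
  shows "rat_cong p (inverse (of_int n)) a"
proof -
  obtain u where u: "1 - n * a = p * u"
    using assms(1) by (metis cong_iff_dvd_diff cong_sym dvdE)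
  have "coprime n p"
    using assms(1) by (metis cong_imp_coprime cong_sym coprime_1_left coprime_mult_left_iff)
  moreover have "(inverse (of_int n) - of_int a) * of_int n = (of_int (p * u) :: rat)"
    unfolding u[symmetric] using assms(2) by (simp add: algebra_simps)
  ultimately show ?thesis unfolding rat_cong_def by blast
qed

lemma T_sum_const: "T_sum (\<lambda>i m. [:v i m:]) k p = [:T_sum v k p:]"
  unfolding T_sum_def by (simp add: poly_const_pow prod_to_poly sum_to_poly)

text \<open>Since p - m \<equiv> -m (mod p), each of the last \<open>d\<close> entries contributes a
  sign (-1)^(k_i).\<close>

lemma cong_reflected_prod:
  fixes m k :: "nat list"
  assumes "length k = e + d" "\<And>i. i < e + d \<Longrightarrow> m ! i < p"
  shows "[(\<Prod>i<e + d. int (glue e (m ! i) (p - m ! i) i) ^ (k ! i)) =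
          (- 1) ^ last_weight d k * (\<Prod>i<e + d. int (m ! i) ^ (k ! i))] (mod int p)"
proof -
  have "[(\<Prod>i<e + d. int (glue e (m ! i) (p - m ! i) i) ^ (k ! i)) =
      (\<Prod>i<e + d. (if i < e then 1 else (- 1) ^ (k ! i)) * int (m ! i) ^ (k ! i))] (mod int p)"
  proof (rule cong_prod)
    fix i assume "i \<in> {..<e + d}"
    hence "[int (p - m ! i) = - int (m ! i)] (mod int p)"
      using assms(2)[of i] by (simp add: of_nat_diff cong_iff_dvd_diff)
    hence "[int (p - m ! i) ^ (k ! i) = (- int (m ! i)) ^ (k ! i)] (mod int p)"
      by (rule cong_pow)
    also have "(- int (m ! i)) ^ (k ! i) = (- 1) ^ (k ! i) * int (m ! i) ^ (k ! i)"
      by (subst power_minus) simp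
    finally show "[int (glue e (m ! i) (p - m ! i) i) ^ (k ! i) =
       (if i < e then 1 else (- 1) ^ (k ! i)) * int (m ! i) ^ (k ! i)] (mod int p)"
      by (simp add: glue_def)
  qed
  also have "(\<Prod>i<e + d. (if i < e then 1 else (- 1 :: int) ^ (k ! i))) = (- 1) ^ last_weight d k"
    unfolding last_weight_eq_sum[OF assms(1)] power_sum
    by (intro prod.mono_neutral_cong_right) auto
  ultimately show ?thesis by (simp add: prod.distrib)
qed

definition inv_sum :: "nat list \<Rightarrow> nat \<Rightarrow> int" where
  "inv_sum k p = (\<Sum>m\<in>T_range (length k) p. modular_inverse (int p) (\<Prod>i<length k. int (m ! i) ^ (k ! i)))"

text \<open>Reflection costs only a sign modulo \<open>p\<close>; \<open>d = 0\<close> is the case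
  without reflection.\<close>

lemma rat_cong_T_sum:
  assumes p: "prime p" and k: "length k = e + d"
  shows "rat_cong (int p) (T_sum (glue e (\<lambda>m. inverse (of_nat m)) (\<lambda>m. inverse (of_nat (p - m)))) k p)
           ((- 1) ^ last_weight d k * inv_sum k p)"
  unfolding T_sum_def inv_sum_def sum_distrib_left
proof (rule rat_cong_sum)
  fix m assume m: "m \<in> T_range (length k) p"
  have bounds: "0 < m ! i \<and> m ! i < p" if "i < e + d" for i
  proof -
    have "m ! i \<in> set m" using m that k by (intro nth_mem) (simp add: T_range_def)
    thus ?thesis using m by (auto simp: T_range_def)
  qed
  let ?N = "\<Prod>i<e + d. int (m ! i) ^ (k ! i)"
  let ?N' = "\<Prod>i<e + d. int (glue e (m ! i) (p - m ! i) i) ^ (k ! i)"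
  have "coprime (int (m ! i)) (int p)" if "i < e + d" for i
    using bounds[OF that] p by (simp add: coprime_commute prime_nat_not_dvd prime_imp_coprime nat_dvd_not_less)
  hence "coprime ?N (int p)"
    by (intro prod_coprime_left) simp
  hence inv: "[?N * modular_inverse (int p) ?N = 1] (mod int p)"
    by (intro cong_modular_inverse1)
  have nz: "int (glue e (m ! i) (p - m ! i) i) \<noteq> 0" if "i < e + d" for i
    using bounds[OF that] by (simp add: glue_def)
  \<comment> \<open>The sign squares to 1, so the signed inverse of \<open>?N\<close> inverts
    \<open>?N'\<close>.\<close>
  have "[?N' * ((- 1) ^ last_weight d k * modular_inverse (int p) ?N) =
      (- 1) ^ last_weight d k * ?N * ((- 1) ^ last_weight d k * modular_inverse (int p) ?N)] (mod int p)"
    by (intro cong_mult cong_refl cong_reflected_prod k) (use bounds in auto)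
  also have "(- 1) ^ last_weight d k * ?N * ((- 1) ^ last_weight d k * modular_inverse (int p) ?N) =
      ?N * modular_inverse (int p) ?N"
    by (simp add: mult_ac flip: power_add mult_2)
  also note inv
  finally have "rat_cong (int p) (inverse (of_int ?N')) ((- 1) ^ last_weight d k * modular_inverse (int p) ?N)"
    using nz by (intro rat_cong_inverse) auto
  also have "inverse (of_int ?N') = (\<Prod>i<length k. glue e (\<lambda>m. inverse (of_nat m)) (\<lambda>m. inverse (of_nat (p - m))) i (m ! i) ^ (k ! i) :: rat)"
    unfolding k of_int_prod prod_inversef[symmetric] by (intro prod.cong refl) (simp add: glue_def power_inverse)
  finally show "rat_cong (int p) (\<Prod>i<length k. glue e (\<lambda>m. inverse (of_nat m)) (\<lambda>m. inverse (of_nat (p - m))) i (m ! i) ^ (k ! i))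
        ((- 1) ^ last_weight d k * modular_inverse (int p) (\<Prod>i<length k. int (m ! i) ^ (k ! i)))"
    unfolding k .
qed

section \<open>Integrality of the bracket in the theorem\<close>

lemma map_poly_of_int_add: "map_poly of_int (P + Q) = (map_poly of_int P + map_poly of_int Q :: 'a::comm_ring_1 poly)"
  by (rule poly_eqI) (simp add: coeff_map_poly)

lemma map_poly_of_int_mult: "map_poly of_int (P * Q) = (map_poly of_int P * map_poly of_int Q :: 'a::comm_ring_1 poly)"
  by (rule poly_eqI) (simp add: coeff_map_poly coeff_mult)

lemma map_poly_of_int_power: "map_poly of_int (P ^ n) = (map_poly of_int P ^ n :: 'a::comm_ring_1 poly)"
  by (induction n) (simp_all add: map_poly_of_int_mult)

lemma map_poly_of_int_uminus: "map_poly of_int (- P) = (- map_poly of_int P :: 'a::comm_ring_1 poly)"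
  by (rule poly_eqI) (simp add: coeff_map_poly)

lemma map_poly_of_int_1: "map_poly of_int 1 = (1 :: 'a::comm_ring_1 poly)"
  by simp

lemma map_poly_of_int_var: "map_poly of_int [:0, 1:] = ([:0, 1:] :: 'a::comm_ring_1 poly)"
  by (simp add: map_poly_pCons)

lemmas map_poly_of_int =
  map_poly_of_int_add map_poly_of_int_mult map_poly_of_int_power map_poly_of_int_uminus map_poly_of_int_1
  map_poly_of_int_var

text \<open>Generic in the coefficient ring, so that the bracket can be read both over the integers
  and over \<open>ring_A\<close>.\<close>

definition weight_poly :: "nat \<Rightarrow> nat \<Rightarrow> 'a::comm_ring_1 poly" where
  "weight_poly w W = (1 + [:0, 1:]) ^ (W - 1) * (1 + [:0, 1:] ^ (w - W - 1)) + (- [:0, 1:]) ^ (W - 1)"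

lemma coeff_weight_poly: "coeff (weight_poly w W) j = (of_int (coeff (weight_poly w W) j) :: 'a::comm_ring_1)"
proof -
  have "weight_poly w W = (map_poly of_int (weight_poly w W) :: 'a poly)"
    by (simp only: weight_poly_def map_poly_of_int)
  thus ?thesis by (metis coeff_map_poly of_int_0)
qed

lemma weighted_sum_mod_prime:
  assumes p: "prime p" "odd p" and r: "even r" "r \<ge> 2"
  shows "int p dvd (\<Sum>k\<in>indices r w. \<Sum>d=1..r-1. coeff (weight_poly w (last_weight d k)) j * T_mod k p)"
proof -
  let ?z = "[:0, 1:] :: rat poly"
  let ?P = "\<lambda>W. (1 + [:0, 1:]) ^ (W - 1) * (1 + [:0, 1:] ^ (w - W - 1)) :: int poly"
  let ?Q = "\<lambda>W. [:0, 1:] ^ (W - 1) :: int poly"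
  let ?v = "\<lambda>e. glue e (\<lambda>m. inverse (of_nat m)) (\<lambda>m. inverse (of_nat (p - m))) :: nat \<Rightarrow> nat \<Rightarrow> rat"
  have P: "(1 + ?z) ^ (W - 1) * (1 + ?z ^ (w - W - 1)) = map_poly of_int (?P W)"
    and Q: "?z ^ (W - 1) = map_poly of_int (?Q W)" for W
    by (simp_all only: map_poly_of_int)
  have v1: "T_sum (glue e recip (\<lambda>m. recip (p - m))) k p = [:T_sum (?v e) k p:]" for e k
    unfolding T_sum_const[symmetric] by (rule arg_cong[of _ _ "\<lambda>v. T_sum v k p"]) (auto simp: glue_def recip_def fun_eq_iff)
  have v2: "T_sum (\<lambda>_. recip) k p = [:T_sum (?v r) k p:]" if "length k = r" for k
    unfolding T_sum_const[symmetric] by (simp add: T_sum_def recip_def glue_def that)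
  have "(\<Sum>k\<in>indices r w. \<Sum>d=1..r-1.
      (1 + ?z) ^ (last_weight d k - 1) * (1 + ?z ^ (w - last_weight d k - 1)) * [:T_sum (?v r) k p:]
      - ?z ^ (last_weight d k - 1) * [:T_sum (?v (r - d)) k p:]) = 0"
    using weighted_sum_exact[OF p(2) r, of ?z w]
    unfolding sum_subtractf v1 by (simp add: v2 indices_def)
  from this[unfolded P, unfolded Q] have "0 = coeff (\<Sum>k\<in>indices r w. \<Sum>d=1..r-1. map_poly of_int (?P (last_weight d k)) * [:T_sum (?v r) k p:]
      - map_poly of_int (?Q (last_weight d k)) * [:T_sum (?v (r - d)) k p:]) j"
    by (simp only: coeff_0)
  also have "\<dots> = (\<Sum>k\<in>indices r w. \<Sum>d=1..r-1.
      of_int (coeff (?P (last_weight d k)) j) * T_sum (?v r) k p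
      - of_int (coeff (?Q (last_weight d k)) j) * T_sum (?v (r - d)) k p)"
    by (simp add: coeff_sum coeff_map_poly mult.commute)
  finally have eq: "0 = \<dots>" .
  have "rat_cong (int p) \<dots> (\<Sum>k\<in>indices r w. \<Sum>d=1..r-1.
      coeff (?P (last_weight d k)) j * inv_sum k p
      - coeff (?Q (last_weight d k)) j * ((- 1) ^ last_weight d k * inv_sum k p))"
  proof (intro rat_cong_sum rat_cong_diff rat_cong_mult rat_cong_of_int)
    fix k d assume kd: "k \<in> indices r w" "d \<in> {1..r - 1}"
    show "rat_cong (int p) (T_sum (?v r) k p) (inv_sum k p)"
      using rat_cong_T_sum[OF p(1), of k r 0] kd by (simp add: indices_def last_weight_def)
    show "rat_cong (int p) (T_sum (?v (r - d)) k p) ((- 1) ^ last_weight d k * inv_sum k p)"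
      by (rule rat_cong_T_sum[OF p(1)]) (use kd in \<open>auto simp: indices_def\<close>)
  qed
  hence "int p dvd (\<Sum>k\<in>indices r w. \<Sum>d=1..r-1.
      coeff (?P (last_weight d k)) j * inv_sum k p
      - coeff (?Q (last_weight d k)) j * ((- 1) ^ last_weight d k * inv_sum k p))"
    unfolding eq[symmetric] by (rule rat_cong_0)
  also have "\<dots> = (\<Sum>k\<in>indices r w. \<Sum>d=1..r-1. coeff (weight_poly w (last_weight d k)) j * inv_sum k p)"
  proof (intro sum.cong refl)
    fix k d assume kd: "k \<in> indices r w" "d \<in> {1..r - 1}"
    have "1 \<le> d" "d < r" using kd(2) r(2) by auto
    from last_weight_bounds(1)[OF kd(1) this] obtain W where W: "last_weight d k = Suc W"
      by (cases "last_weight d k") auto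
    \<comment> \<open>As the last weight is \<open>Suc W\<close>, the subtracted reflected term has
      sign -(-1)^(W+1) = (-1)^W and becomes (-z)^W.\<close>
    have "(- [:0, 1:] :: int poly) ^ W = smult ((- 1) ^ W) ([:0, 1:] ^ W)"
      using smult_power[of "-1" "[:0, 1 :: int:]" W] by simp
    thus "coeff (?P (last_weight d k)) j * inv_sum k p
      - coeff (?Q (last_weight d k)) j * ((- 1) ^ last_weight d k * inv_sum k p)
      = coeff (weight_poly w (last_weight d k)) j * inv_sum k p"
      by (simp add: W weight_poly_def algebra_simps)
  qed
  finally have "int p dvd 2 ^ r * (\<Sum>k\<in>indices r w. \<Sum>d=1..r-1. coeff (weight_poly w (last_weight d k)) j * inv_sum k p)"
    by (rule dvd_mult)
  also have "\<dots> = (\<Sum>k\<in>indices r w. \<Sum>d=1..r-1. coeff (weight_poly w (last_weight d k)) j * T_mod k p)"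
    unfolding sum_distrib_left
    by (intro sum.cong refl) (simp add: T_mod_def inv_sum_def indices_def sum_distrib_left mult_ac)
  finally show ?thesis .
qed

section \<open>Passage to \<open>ring_A\<close>\<close>

lemma of_nat_ring_A: "of_nat n = abs_ring_A (\<lambda>_. int n)"
  by (induction n) (simp_all add: zero_ring_A_def one_ring_A_def plus_ring_A.abs_eq)

lemma of_int_ring_A: "of_int n = abs_ring_A (\<lambda>_. n)"
  by (cases n) (simp_all add: of_nat_ring_A uminus_ring_A.abs_eq del: of_nat_Suc)

lemma sum_abs_ring_A: "(\<Sum>x\<in>A. abs_ring_A (f x)) = abs_ring_A (\<lambda>p. \<Sum>x\<in>A. f x p)"
  by (induction A rule: infinite_finite_induct) (simp_all add: zero_ring_A_def plus_ring_A.abs_eq)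

text \<open>Divisibility may fail at the prime 2 only, and a single component does not matter in the
  quotient.\<close>

lemma abs_ring_A_eq_0:
  assumes "\<And>p. prime p \<Longrightarrow> odd p \<Longrightarrow> int p dvd f p"
  shows "abs_ring_A f = 0"
  unfolding zero_ring_A_def ring_A.abs_eq_iff fin_diff_def
proof (rule finite_subset)
  show "{p. prime p \<and> \<not> [f p = 0] (mod int p)} \<subseteq> {2}"
    using assms by (auto simp: cong_0_iff) (metis primes_dvd_imp_eq two_is_prime_nat)
qed simp

theorem theorem1p2:
  fixes w r :: nat and z :: "ring_A poly"
  defines "z \<equiv> [:0, 1:]"
  assumes "r \<ge> 2" and "w \<ge> r" and "even r"
  shows "(\<Sum>k\<in>indices r w. \<Sum>d=1..r-1.
            ((1 + z) ^ (last_weight d k - 1) * (1 + z ^ (w - last_weight d k - 1))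
              + (- z) ^ (last_weight d k - 1)) * [:T_A k:]) = 0"
proof (rule poly_eqI)
  fix j
  \<comment> \<open>Each coefficient in z is an integer combination of the \<open>T_A k\<close> and
    can be computed on representatives.\<close>
  have "coeff (\<Sum>k\<in>indices r w. \<Sum>d=1..r-1. weight_poly w (last_weight d k) * [:T_A k:]) j =
      (\<Sum>k\<in>indices r w. \<Sum>d=1..r-1. of_int (coeff (weight_poly w (last_weight d k)) j) * T_A k)"
    by (simp add: coeff_sum mult.commute flip: coeff_weight_poly)
  also have "\<dots> = abs_ring_A (\<lambda>p. \<Sum>k\<in>indices r w. \<Sum>d=1..r-1. coeff (weight_poly w (last_weight d k)) j * T_mod k p)"
    by (simp add: of_int_ring_A T_A.abs_eq times_ring_A.abs_eq sum_abs_ring_A)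
  also have "\<dots> = 0"
    by (rule abs_ring_A_eq_0) (rule weighted_sum_mod_prime; use assms in simp)
  finally show "coeff (\<Sum>k\<in>indices r w. \<Sum>d=1..r-1.
            ((1 + z) ^ (last_weight d k - 1) * (1 + z ^ (w - last_weight d k - 1))
              + (- z) ^ (last_weight d k - 1)) * [:T_A k:]) j = coeff 0 j"
    by (simp add: weight_poly_def z_def)
qed

end
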